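(* Let $d\ge1$, let $c>0$ and let $C\ge c/2$. Let $n\in\mathbb{N}$ and let $\mathcal{X}_n$ be a discrete subset of $\mathbb{R}^d$ that is well-separated in the sense that $$\inf_{\substack{x\neq y\\ x,y\in\mathcal{X}_n}}|x-y|\ \ge\ c\,n^{-1/d}.$$ Fix a center $x_0\in\mathbb{R}^d$ and for $j=1,2,\ldots$ let $$\mathcal{A}_{n,j}=\{y\in\mathbb{R}^d:\ (j-1)\,C n^{-1/d}\le|y-x_0|<j\,Cn^{-1/d}\}.$$ Then $$\left|\mathcal{X}_n\cap\mathcal{A}_{n,j}\right|\ \le\ K_d\left[j^d-(j-1)^d\right],\qquad j=1,2,\ldots,$$ where $$K_d=K_d(c,C)=2^{\frac{3d+3}{2}}\left(\frac{C}{c}\right)^d.$$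
   Context: $|x-y|$ is Euclidean distance in $\mathbb{R}^d$ and $|E|$ denotes the cardinality of a set $E$. The sets $\mathcal{A}_{n,j}$ are concentric annuli of common thickness $Cn^{-1/d}$, the first one being a ball of radius $Cn^{-1/d}$. *)

theory Defs
  imports "HOL-Analysis.Analysis"
begin

(* The infimum is taken in the extended reals, so that it is \<infinity> when X has at most one point;
   on type real, Inf {} would be an arbitrary value. *)
definition well_separated :: "real \<Rightarrow> 'a::metric_space set \<Rightarrow> bool" where
  "well_separated r X \<longleftrightarrow> Inf {ereal (dist x y) | x y. x \<in> X \<and> y \<in> X \<and> x \<noteq> y} \<ge> ereal r"

(* The dimension d is CARD('d), which is at least 1 for every finite type. *)
definition annulus :: "real \<Rightarrow> real ^ 'd \<Rightarrow> nat \<Rightarrow> nat \<Rightarrow> (real ^ 'd) set" where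
  "annulus C x0 n j =
    {y. (real j - 1) * C * real n powr (- 1 / real CARD('d)) \<le> dist y x0 \<and>
        dist y x0 < real j * C * real n powr (- 1 / real CARD('d))}"

definition K_const :: "nat \<Rightarrow> real \<Rightarrow> real \<Rightarrow> real" where
  "K_const d c C = 2 powr ((3 * real d + 3) / 2) * (C / c) ^ d"

end

theory Submission
  imports Defs
begin

text \<open>
  Around each point \<open>x\<close> of the annulus put the open ball of radius half the separation; these balls
  are disjoint. Each of them contains a half ball of radius \<open>1/\<surd>2\<close> times its own radius that lies
  inside the annulus: pull \<open>x\<close> radially towards the centre, just far enough that the
  outward-facing half ball at the new point \<open>m\<close> does not cross the outer sphere. It does not cross
  the inner sphere because moving outwards from \<open>m\<close> increases the distance to the centre, and it
  stays near \<open>x\<close> because it faces \<open>x\<close>. Comparing volumes gives the bound, even with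
  \<open>2^((3d+2)/2)\<close> in place of \<open>2^((3d+3)/2)\<close>.
\<close>

text \<open>The vector \<open>w\<close> only fixes a direction and is not normalised. For
  \<open>w = 0\<close> the whole ball results, so a point at the centre \<open>x0\<close> needs no
  separate case.\<close>

definition half_ball :: "'a::euclidean_space \<Rightarrow> real \<Rightarrow> 'a \<Rightarrow> 'a set" where
  "half_ball m s w = {y \<in> ball m s. 0 \<le> (y - m) \<bullet> w}"

lemma lmeasurable_half_ball: "half_ball m s w \<in> lmeasurable"
proof (rule bounded_set_imp_lmeasurable)
  show "bounded (half_ball m s w)"
    by (rule bounded_subset[OF bounded_ball[of m s]]) (auto simp: half_ball_def)
  have "half_ball m s w = ball m s \<inter> {y. 0 \<le> (y - m) \<bullet> w}"
    by (auto simp: half_ball_def)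
  moreover have "closed {y. 0 \<le> (y - m) \<bullet> w}"
    by (intro closed_Collect_le continuous_intros)
  ultimately show "half_ball m s w \<in> sets lebesgue"
    by (simp add: fmeasurableD sets.Int)
qed

text \<open>The point reflection \<open>y\<close> to \<open>2m - y\<close> preserves measure and
  swaps the half balls for \<open>w\<close> and \<open>-w\<close>, which together cover the ball.
  They overlap in the dividing hyperplane, so subadditivity gives the inequality.\<close>

lemma measure_half_ball_ge:
  fixes m w :: "'a::euclidean_space"
  assumes "0 \<le> s"
  shows "unit_ball_vol (real DIM('a)) * s ^ DIM('a) \<le> 2 * measure lebesgue (half_ball m s w)"
proof -
  let ?H = "half_ball m s w" and ?f = "\<lambda>y. (-1) *\<^sub>R y + 2 *\<^sub>R m"
  have image: "?f ` ?H = half_ball m s (- w)"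
  proof (intro equalityI subsetI)
    fix y assume "y \<in> ?f ` ?H"
    then show "y \<in> half_ball m s (- w)"
      by (auto simp: half_ball_def dist_norm algebra_simps scaleR_2 norm_minus_commute)
  next
    fix y assume "y \<in> half_ball m s (- w)"
    then have "?f y \<in> ?H"
      by (auto simp: half_ball_def dist_norm algebra_simps scaleR_2 norm_minus_commute)
    moreover have "y = ?f (?f y)" by simp
    ultimately show "y \<in> ?f ` ?H" by blast
  qed
  have "measure lebesgue (half_ball m s (- w)) = measure lebesgue ?H"
    using measure_lebesgue_affine[of "-1" "2 *\<^sub>R m" ?H] by (simp add: image[simplified] add.commute)
  moreover have "ball m s = ?H \<union> half_ball m s (- w)"
    by (auto simp: half_ball_def)
  then have "measure lebesgue (ball m s)
      \<le> measure lebesgue ?H + measure lebesgue (half_ball m s (- w))"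
    by (simp add: measure_Un_le fmeasurableD lmeasurable_half_ball)
  ultimately show ?thesis
    using content_ball[OF assms, of m] by simp
qed

lemma half_ball_in_annulus:
  fixes x x0 :: "'a::euclidean_space"
  assumes s: "0 < s" "s \<le> R - \<rho>" and "0 \<le> \<rho>" and x: "\<rho> \<le> dist x x0" "dist x x0 < R"
  obtains m where "half_ball m s (x - x0) \<subseteq> (ball x0 R - ball x0 \<rho>) \<inter> ball x (sqrt 2 * s)"
proof -
  define w where "w = x - x0"
  have w: "\<rho> \<le> norm w" "norm w < R" using x by (auto simp: w_def dist_norm)
  \<comment> \<open>The new point will be \<open>m = x0 + t w\<close>. The last three conditions say
    that \<open>m\<close> is not inside the inner sphere, that the \<open>s\<close>-ball at
    \<open>m\<close> stays inside the outer one, and that \<open>m\<close> is within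
    \<open>s\<close> of \<open>x\<close>.\<close>
  obtain t where t: "0 \<le> t" "t \<le> 1" "\<rho> \<le> t * norm w" "t * norm w + s \<le> R" "(1 - t) * norm w \<le> s"
  proof (cases "norm w + s \<le> R")
    case True
    then show ?thesis using that[of 1] w s by simp
  next
    case False
    then have "norm w > 0" using assms by linarith
    show ?thesis
    \<comment> \<open>This \<open>t\<close> puts \<open>m\<close> at distance \<open>R - s\<close>
      from \<open>x0\<close>, where its \<open>s\<close>-ball touches the outer sphere from inside.
      The shift is \<open>norm w - (R - s)\<close>, below \<open>s\<close> because
      \<open>norm w < R\<close>.\<close>
    proof (rule that[of "(R - s) / norm w"])
      have "(R - s) / norm w * norm w = R - s" using \<open>norm w > 0\<close> by simp
      then show "\<rho> \<le> (R - s) / norm w * norm w" "(R - s) / norm w * norm w + s \<le> R"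
        "(1 - (R - s) / norm w) * norm w \<le> s"
        using s w by (simp_all only: left_diff_distrib mult_1_left)
      show "0 \<le> (R - s) / norm w" using assms by simp
      show "(R - s) / norm w \<le> 1" using \<open>norm w > 0\<close> False by simp
    qed
  qed
  define m where "m = x0 + t *\<^sub>R w"
  have "half_ball m s w \<subseteq> (ball x0 R - ball x0 \<rho>) \<inter> ball x (sqrt 2 * s)"
  proof
    fix y assume y: "y \<in> half_ball m s w"
    define v where "v = y - m"
    have v: "norm v < s" "0 \<le> v \<bullet> w"
      using y by (auto simp: half_ball_def v_def dist_norm norm_minus_commute)
    have y0: "y - x0 = t *\<^sub>R w + v" and yx: "y - x = v - (1 - t) *\<^sub>R w"
      by (simp_all add: v_def m_def w_def algebra_simps)
    have "norm (y - x0) \<le> t * norm w + norm v"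
      using norm_triangle_ineq[of "t *\<^sub>R w" v] t by (simp add: y0)
    then have outer: "norm (y - x0) < R" using v t by linarith
    \<comment> \<open>Expanding the square, the cross term \<open>2 t (v \<bullet> w)\<close> is
      nonnegative on the half ball.\<close>
    have "(t * norm w)\<^sup>2 \<le> (norm (y - x0))\<^sup>2"
      using v t unfolding y0 power_mult_distrib power2_norm_eq_inner
      by (simp add: inner_add_left inner_add_right inner_commute power2_eq_square)
    then have inner: "\<rho> \<le> norm (y - x0)"
      using t power2_le_imp_le[of "t * norm w" "norm (y - x0)"] by simp
    have "(norm (y - x))\<^sup>2 = (norm v)\<^sup>2 - 2 * (1 - t) * (v \<bullet> w) + ((1 - t) * norm w)\<^sup>2"
      unfolding yx power_mult_distrib power2_norm_eq_inner
      by (simp add: inner_diff_left inner_diff_right inner_commute power2_eq_square algebra_simps)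
    also have "\<dots> \<le> (norm v)\<^sup>2 + ((1 - t) * norm w)\<^sup>2"
      using v t by simp
    also have "\<dots> < s\<^sup>2 + s\<^sup>2"
      using v t by (intro add_less_le_mono power_strict_mono power_mono) auto
    also have "\<dots> = (sqrt 2 * s)\<^sup>2" by (simp add: power_mult_distrib)
    finally have "norm (y - x) < sqrt 2 * s"
      by (rule power2_less_imp_less) (use s in simp)
    with outer inner show "y \<in> (ball x0 R - ball x0 \<rho>) \<inter> ball x (sqrt 2 * s)"
      by (simp add: dist_norm norm_minus_commute)
  qed
  then show thesis using that by (simp add: w_def)
qed

lemma card_separated_in_annulus_le:
  fixes S :: "'a::euclidean_space set" and x0 :: 'a
  assumes s: "0 < s" "s \<le> R - \<rho>" and "0 \<le> \<rho>"
    and S: "\<And>x. x \<in> S \<Longrightarrow> \<rho> \<le> dist x x0 \<and> dist x x0 < R"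
    and sep: "\<And>x y. x \<in> S \<Longrightarrow> y \<in> S \<Longrightarrow> x \<noteq> y \<Longrightarrow> 2 * sqrt 2 * s \<le> dist x y"
  shows "finite S \<and> real (card S) \<le> 2 * (R ^ DIM('a) - \<rho> ^ DIM('a)) / s ^ DIM('a)"
proof -
  define B where "B = 2 * (R ^ DIM('a) - \<rho> ^ DIM('a)) / s ^ DIM('a)"
  define u where "u = unit_ball_vol (real DIM('a))"
  \<comment> \<open>Subtracting an open ball keeps the inner sphere, so this is exactly the
    half-open annulus.\<close>
  let ?A = "ball x0 R - ball x0 \<rho>"
  have u: "u > 0" by (simp add: u_def)
  have "\<forall>x\<in>S. \<exists>m. half_ball m s (x - x0) \<subseteq> ?A \<inter> ball x (sqrt 2 * s)"
    using half_ball_in_annulus[OF s \<open>0 \<le> \<rho>\<close>] S by metis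
  then obtain m where m: "\<And>x. x \<in> S \<Longrightarrow> half_ball (m x) s (x - x0) \<subseteq> ?A \<inter> ball x (sqrt 2 * s)"
    by metis
  define H where "H x = half_ball (m x) s (x - x0)" for x
  have H: "H x \<in> lmeasurable" for x by (simp add: H_def lmeasurable_half_ball)
  have A: "measure lebesgue ?A = u * (R ^ DIM('a) - \<rho> ^ DIM('a))"
  proof -
    have "measure lebesgue ?A = measure lebesgue (ball x0 R) - measure lebesgue (ball x0 \<rho>)"
      using s by (intro measurable_measure_Diff) (auto simp: fmeasurableD subset_ball)
    then show ?thesis
      using content_ball[of R x0] content_ball[of \<rho> x0] assms by (simp add: u_def algebra_simps)
  qed
  \<comment> \<open>Volumes are compared for finite \<open>F\<close> only, as finiteness of
    \<open>S\<close> is itself to be shown; it follows because the bound \<open>B\<close> is the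
    same for all \<open>F\<close>.\<close>
  have card_le: "real (card F) \<le> B" if F: "F \<subseteq> S" "finite F" for F
  proof -
    have disj: "pairwise (\<lambda>x y. disjnt (H x) (H y)) F"
    proof (rule pairwiseI)
      fix x y assume xy: "x \<in> F" "y \<in> F" "x \<noteq> y"
      then have "2 * sqrt 2 * s \<le> dist x y" using sep F by blast
      then have "disjnt (ball x (sqrt 2 * s)) (ball y (sqrt 2 * s))"
        by (intro disjoint_ballI[folded disjnt_def]) (simp add: algebra_simps)
      then show "disjnt (H x) (H y)"
        using m xy F unfolding H_def disjnt_def by blast
    qed
    have "real (card F) * (u * s ^ DIM('a)) = (\<Sum>x\<in>F. u * s ^ DIM('a))" by simp
    also have "\<dots> \<le> (\<Sum>x\<in>F. 2 * measure lebesgue (H x))"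
      unfolding u_def H_def using s by (intro sum_mono measure_half_ball_ge) simp
    also have "\<dots> = 2 * measure lebesgue (\<Union>x\<in>F. H x)"
      using measure_UNION'[OF F(2) _ disj] H by (simp add: sum_distrib_left)
    also have "measure lebesgue (\<Union>x\<in>F. H x) \<le> measure lebesgue ?A"
      using m F H unfolding H_def
      by (intro measure_mono_fmeasurable) (auto simp: fmeasurableD fmeasurable_Diff)
    finally have "u * (real (card F) * s ^ DIM('a)) \<le> u * (2 * (R ^ DIM('a) - \<rho> ^ DIM('a)))"
      by (simp add: A mult_ac)
    then show ?thesis
      using s u by (simp add: B_def pos_le_divide_eq)
  qed
  then have "finite S \<and> card S \<le> nat \<lfloor>B\<rfloor>"
    by (intro finite_if_finite_subsets_card_bdd) (simp add: le_nat_floor)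
  then show ?thesis using card_le[of S] by (simp add: B_def)
qed

lemma well_separatedD:
  assumes "well_separated r X" "x \<in> X" "y \<in> X" "x \<noteq> y"
  shows "r \<le> dist x y"
proof -
  have "ereal r \<le> ereal (dist x y)"
    using assms unfolding well_separated_def le_Inf_iff by blast
  then show ?thesis by simp
qed

theorem proposition2p2:
  fixes X :: "(real ^ 'd) set" and x0 :: "real ^ 'd" and c C :: real and n :: nat
  assumes "c > 0" and "C \<ge> c / 2" and "n \<ge> 1"
    and "discrete X"
    and "well_separated (c * real n powr (- 1 / real CARD('d))) X"
  shows "\<forall>j\<ge>1. finite (X \<inter> annulus C x0 n j) \<and>
    real (card (X \<inter> annulus C x0 n j))
      \<le> K_const CARD('d) c C * (real j ^ CARD('d) - (real j - 1) ^ CARD('d))"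
proof (intro allI impI)
  fix j :: nat assume j: "1 \<le> j"
  let ?d = "CARD('d)" and ?S = "X \<inter> annulus C x0 n j"
  define q where "q = real n powr (- 1 / real ?d)"
  \<comment> \<open>Chosen so that \<open>sqrt 2 * s\<close> is half the separation
    \<open>c * q\<close>.\<close>
  define s where "s = c * q / (2 * sqrt 2)"
  define D where "D = real j ^ ?d - (real j - 1) ^ ?d"
  have pos: "q > 0" "C > 0" "s > 0" using assms by (auto simp: q_def s_def)
  \<comment> \<open>The half balls must fit into the thickness \<open>C * q\<close> of the annulus;
    this is where \<open>C \<ge> c / 2\<close> enters.\<close>
  have "s \<le> c * q / 2"
    using assms pos by (simp add: s_def field_simps)
  also have "\<dots> \<le> C * q" using assms pos by (simp add: field_simps)
  finally have sC: "s \<le> C * q" .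
  have D: "D \<ge> 0" using j by (simp add: D_def power_mono)
  have sep: "2 * sqrt 2 * s = c * q" by (simp add: s_def)
  have "finite ?S \<and> real (card ?S)
      \<le> 2 * ((real j * C * q) ^ ?d - ((real j - 1) * C * q) ^ ?d) / s ^ ?d"
  proof (rule card_separated_in_annulus_le[where 'a = "real ^ 'd", unfolded DIM_cart DIM_real mult_1_right])
    show "s \<le> real j * C * q - (real j - 1) * C * q" using sC by (simp add: algebra_simps)
    show "(real j - 1) * C * q \<le> dist x x0 \<and> dist x x0 < real j * C * q" if "x \<in> ?S" for x
      using that unfolding annulus_def q_def by blast
    show "2 * sqrt 2 * s \<le> dist x y" if "x \<in> ?S" "y \<in> ?S" "x \<noteq> y" for x y
      using well_separatedD[OF assms(5)] that unfolding sep q_def by blast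
  qed (use pos j in auto)
  moreover have "2 * ((a * C * q) ^ ?d - (b * C * q) ^ ?d) / s ^ ?d
      = 2 * (C * q / s) ^ ?d * (a ^ ?d - b ^ ?d)" for a b
    by (simp add: power_mult_distrib power_divide right_diff_distrib diff_divide_distrib mult_ac)
  \<comment> \<open>The scale \<open>q\<close> cancels, which makes the bound independent of
    \<open>n\<close>.\<close>
  moreover have "2 * (C * q / s) ^ ?d = 2 * (2 * sqrt 2) ^ ?d * (C / c) ^ ?d"
    using pos assms(1) by (simp add: s_def power_divide power_mult_distrib)
  \<comment> \<open>The left side carries the power \<open>2 powr (1 + 3 d / 2)\<close>, a factor
    \<open>sqrt 2\<close> below the one in \<open>K_const\<close>.\<close>
  moreover have "2 * (2 * sqrt 2) ^ ?d * (C / c) ^ ?d \<le> K_const ?d c C"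
  proof -
    have "(2 :: real) * sqrt 2 = 2 powr (3 / 2)"
      using powr_add[of 2 1 "1 / 2 :: real"] by (simp add: powr_half_sqrt)
    then have "2 * (2 * sqrt 2) ^ ?d = 2 powr (1 + 3 / 2 * real ?d)"
      by (simp add: powr_add powr_powr flip: powr_realpow)
    also have "\<dots> \<le> 2 powr ((3 * real ?d + 3) / 2)"
      by (intro powr_mono) auto
    finally show ?thesis
      using pos assms(1) unfolding K_const_def by (intro mult_right_mono) auto
  qed
  ultimately have "finite ?S" "real (card ?S) \<le> 2 * (2 * sqrt 2) ^ ?d * (C / c) ^ ?d * D"
    and K: "2 * (2 * sqrt 2) ^ ?d * (C / c) ^ ?d \<le> K_const ?d c C"
    by (simp_all only: D_def)
  then show "finite ?S \<and> real (card ?S) \<le> K_const ?d c C * (real j ^ ?d - (real j - 1) ^ ?d)"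
    using mult_right_mono[OF K D] unfolding D_def by linarith
qed

end
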